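(* The sequence $k(n)$ satisfies $k(0)=2$, $k(1)=7$, $k(2)=51$, $k(3)=634$, and $k(4)=12623$.
   Context: For a natural number $m$, $T(m)$ denotes the number of distinct topologies which can be defined on a set with $m$ elements (topologies are counted as distinct families of subsets, not up to homeomorphism). For each integer $n\geq 0$, $k(n)$ is defined to be the unique integer such that $T(p+n)\equiv k(n) \pmod p$ for all primes $p$ (such an integer exists and is unique for each $n\ge 0$). *)

theory Defs
  imports "HOL-Analysis.Abstract_Topology" "HOL-Number_Theory.Cong"
begin

(* A value of type nat topology is determined by its family of open sets, so this counts
   topologies as families of subsets of the m-element set {..<m}, not up to homeomorphism. *)
definition num_topologies :: "nat \<Rightarrow> nat" where
  "num_topologies m = card {X :: nat topology. topspace X = {..<m}}"

definition k_seq :: "nat \<Rightarrow> int" where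
  "k_seq n = (THE c :: int. \<forall>p :: nat. prime p \<longrightarrow> [int (num_topologies (p + n)) = c] (mod int p))"

end

theory Submission
  imports Defs
begin

text \<open>
On a finite set, topologies and preorders are the same thing: a topology is recovered from its
specialization preorder, whose up-sets are the open sets
(\<open>card_topologies_eq_card_preorders\<close>).  So \<open>T(p + n)\<close> counts the preorders on \<open>p + n\<close> points.

Let the cyclic group of prime order \<open>p\<close> act by rotating a block of \<open>p\<close> points and fixing the other
\<open>n\<close>.  The non-fixed preorders come in orbits of size \<open>p\<close>, so \<open>T(p + n)\<close> is congruent modulo \<open>p\<close> to
the number of invariant preorders (\<open>cong_card_fixed_points\<close>).  In an invariant preorder the points
of the block all relate to an outside point in the same way, and since \<open>p\<close> is prime they are either
pairwise incomparable or all equivalent.  Hence an invariant preorder amounts to a preorder on the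
\<open>n + 1\<close> points left after contracting the block to one point \<open>0\<close>, together with the choice between
a discrete and an indiscrete block; the discrete choice is available exactly when no other point is
equivalent to \<open>0\<close> (\<open>card_rot_invariant_preorders\<close>).  This gives a number independent of \<open>p\<close>:
\<open>k(n)\<close> is the number of preorders on \<open>{0, \<dots>, n}\<close>, where those in which the class of \<open>0\<close> is a
singleton count twice.  As there are infinitely many primes, the congruences determine it.

The number is found by enumeration.  A preorder on one more point is a preorder together with an
up-set \<open>U\<close> and a down-set \<open>D\<close> of points above and below the new one, such that every element of
\<open>D\<close> lies below every element of \<open>U\<close> (\<open>preorder_matrix_border\<close>).  Listing Boolean matrices in this
way, one row and column at a time, yields 1, 4, 29, 355 and 6942 preorders, of which 1, 3, 22, 279
and 5681 have \<open>0\<close> in a singleton class.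
\<close>

section \<open>Finite topologies and preorders\<close>

definition specialization :: "'a topology \<Rightarrow> 'a rel" where
  "specialization X =
    {(x, y). x \<in> topspace X \<and> y \<in> topspace X \<and> (\<forall>U. openin X U \<and> x \<in> U \<longrightarrow> y \<in> U)}"

definition up_topology :: "'a set \<Rightarrow> 'a rel \<Rightarrow> 'a topology" where
  "up_topology A r = topology (\<lambda>U. U \<subseteq> A \<and> (\<forall>x\<in>U. \<forall>y. (x, y) \<in> r \<longrightarrow> y \<in> U))"

lemma openin_up_topology:
  "openin (up_topology A r) U \<longleftrightarrow> U \<subseteq> A \<and> (\<forall>x\<in>U. \<forall>y. (x, y) \<in> r \<longrightarrow> y \<in> U)"
proof -
  have "istopology (\<lambda>U. U \<subseteq> A \<and> (\<forall>x\<in>U. \<forall>y. (x, y) \<in> r \<longrightarrow> y \<in> U))"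
    unfolding istopology_def by blast
  then show ?thesis
    by (simp add: up_topology_def topology_inverse')
qed

lemma topspace_up_topology:
  assumes "r \<subseteq> A \<times> A"
  shows "topspace (up_topology A r) = A"
  using assms unfolding topspace_def openin_up_topology by auto

lemma preorder_specialization: "preorder_on (topspace X) (specialization X)"
  unfolding preorder_on_def specialization_def refl_on_def trans_def by blast

text \<open>The up-set \<open>{z. (x, z) \<in> r}\<close> is itself open, so it tests the specialization relation at
\<open>x\<close>: any \<open>y\<close> above \<open>x\<close> in the specialization order must belong to it.\<close>

lemma specialization_up_topology:
  assumes "preorder_on A r"
  shows "specialization (up_topology A r) = r"
proof -
  have sub: "r \<subseteq> A \<times> A" and refl: "\<And>x. x \<in> A \<Longrightarrow> (x, x) \<in> r" and "trans r"
    using assms by (auto simp: preorder_on_def refl_on_def)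
  have "(x, y) \<in> r"
    if "x \<in> A" and *: "\<And>U. openin (up_topology A r) U \<Longrightarrow> x \<in> U \<Longrightarrow> y \<in> U" for x y
  proof -
    have "openin (up_topology A r) {z. (x, z) \<in> r}"
      using sub \<open>trans r\<close> unfolding openin_up_topology trans_def by blast
    then show ?thesis
      using *[of "{z. (x, z) \<in> r}"] refl[OF \<open>x \<in> A\<close>] by simp
  qed
  then have "specialization (up_topology A r) \<subseteq> r"
    unfolding specialization_def topspace_up_topology[OF sub] by blast
  moreover have "r \<subseteq> specialization (up_topology A r)"
    using sub unfolding specialization_def topspace_up_topology[OF sub] openin_up_topology by blast
  ultimately show ?thesis
    by (rule subset_antisym)
qed

text \<open>The intersection of all open neighbourhoods of a point is a finite one, because the space is
finite; hence it is open, and it is the set of points above that point.  An up-set is the union of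
these minimal neighbourhoods.\<close>

lemma up_topology_specialization:
  assumes fin: "finite (topspace X)"
  shows "up_topology (topspace X) (specialization X) = X"
proof -
  have "openin X U"
    if sub: "U \<subseteq> topspace X"
      and up: "\<And>x y. x \<in> U \<Longrightarrow> (x, y) \<in> specialization X \<Longrightarrow> y \<in> U" for U
  proof (subst openin_subopen, intro ballI)
    fix x assume x: "x \<in> U"
    let ?N = "\<Inter>{V. openin X V \<and> x \<in> V}"
    have "finite {V. openin X V \<and> x \<in> V}"
      by (rule finite_subset[of _ "Pow (topspace X)"]) (auto simp: fin dest: openin_subset)
    moreover have "topspace X \<in> {V. openin X V \<and> x \<in> V}"
      using x sub by auto
    ultimately have "openin X ?N"
      by (intro openin_Inter) auto
    moreover have "?N \<subseteq> U"
      using up[OF x] x sub unfolding specialization_def by auto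
    ultimately show "\<exists>T. openin X T \<and> x \<in> T \<and> T \<subseteq> U"
      by auto
  qed
  moreover have "y \<in> U" if "openin X U" "x \<in> U" "(x, y) \<in> specialization X" for U x y
    using that by (simp add: specialization_def)
  ultimately have "openin (up_topology (topspace X) (specialization X)) U \<longleftrightarrow> openin X U" for U
    unfolding openin_up_topology using openin_subset by metis
  then show ?thesis
    by (simp add: topology_eq)
qed

lemma card_topologies_eq_card_preorders:
  assumes "finite A"
  shows "card {X. topspace X = A} = card {r. preorder_on A r}"
proof -
  have "bij_betw specialization {X. topspace X = A} {r. preorder_on A r}"
  proof (rule bij_betw_byWitness[where f' = "up_topology A"])
    show "\<forall>X\<in>{X. topspace X = A}. up_topology A (specialization X) = X"
      using assms up_topology_specialization by auto
    show "\<forall>r\<in>{r. preorder_on A r}. specialization (up_topology A r) = r"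
      by (simp add: specialization_up_topology)
    show "specialization ` {X. topspace X = A} \<subseteq> {r. preorder_on A r}"
      using preorder_specialization by auto
    show "up_topology A ` {r. preorder_on A r} \<subseteq> {X. topspace X = A}"
      by (auto simp: preorder_on_def topspace_up_topology)
  qed
  then show ?thesis
    by (rule bij_betw_same_card)
qed

section \<open>Fixed points of a map of prime order\<close>

lemma fixed_if_coprime_iterate_fixed:
  assumes "(f ^^ k) x = x" and "(f ^^ p) x = x" and "coprime k p" and "1 < p"
  shows "f x = x"
proof -
  obtain m where "[k * m = 1] (mod p)"
    using cong_solve_coprime_nat[OF \<open>coprime k p\<close>] by auto
  then have "(k * m) mod p = 1"
    using \<open>1 < p\<close> by (simp add: cong_def)
  then have "f x = (f ^^ (k * m mod p)) x"
    by simp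
  also have "\<dots> = (f ^^ (k * m)) x"
    by (rule funpow_mod_eq[OF assms(2)])
  also have "\<dots> = x"
    using funpow_mod_eq[OF assms(1), of "k * m"] by simp
  finally show ?thesis .
qed

lemma coprime_below_prime:
  fixes k p :: nat
  assumes "prime p" and "0 < k" and "k < p"
  shows "coprime k p"
proof -
  have "coprime p k"
    using assms by (intro prime_imp_coprime) (auto dest: dvd_imp_le)
  then show ?thesis
    by (simp only: coprime_commute)
qed

text \<open>The non-fixed points fall into orbits, and an orbit with fewer than \<open>p\<close> points would be one on
which an iterate \<open>f ^^ k\<close> with \<open>0 < k < p\<close> has a fixed point; as \<open>k\<close> is invertible modulo \<open>p\<close>,
\<open>f\<close> itself would fix that point.\<close>

lemma cong_card_fixed_points:
  fixes f :: "'a \<Rightarrow> 'a"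
  assumes p: "prime p" and fin: "finite S" and maps: "f ` S \<subseteq> S"
    and period: "\<And>x. x \<in> S \<Longrightarrow> (f ^^ p) x = x"
  shows "[card S = card {x \<in> S. f x = x}] (mod p)"
proof -
  let ?N = "{x \<in> S. f x \<noteq> x}"
  define R where "R = {(x, y). x \<in> ?N \<and> y \<in> ?N \<and> (\<exists>i. y = (f ^^ i) x)}"
  have p1: "1 < p"
    using p prime_gt_1_nat by blast
  \<comment> \<open>As \<open>f ^^ (p * i)\<close> is the identity, \<open>f ^^ i\<close> is inverted by a further iterate.\<close>
  have return: "(f ^^ (p * i - i)) ((f ^^ i) x) = x" if "x \<in> S" for x i
  proof -
    have "(f ^^ (p * i - i)) ((f ^^ i) x) = (f ^^ (p * i - i + i)) x"
      by (simp add: funpow_add)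
    also have "p * i - i + i = p * i"
      using p1 by simp
    also have "(f ^^ (p * i)) x = x"
      using funpow_mod_eq[OF period[OF that], of "p * i"] by simp
    finally show ?thesis .
  qed
  have N_closed: "(f ^^ i) x \<in> ?N" if x: "x \<in> ?N" for x i
  proof -
    have "(f ^^ i) x \<in> S"
      using x maps by (induction i) auto
    moreover have "f ((f ^^ i) x) \<noteq> (f ^^ i) x"
    proof
      assume fixed: "f ((f ^^ i) x) = (f ^^ i) x"
      have "(f ^^ k) ((f ^^ i) x) = (f ^^ i) x" for k
        by (induction k) (use fixed in auto)
      then show False
        using return[of x i] x fixed by auto
    qed
    ultimately show ?thesis
      by simp
  qed
  have "equiv ?N R"
  proof (rule equivI)
    show "R \<subseteq> ?N \<times> ?N"
      by (auto simp: R_def)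
    show "refl_on ?N R"
      by (auto simp: R_def refl_on_def intro: exI[of _ 0])
    show "sym R"
    proof (rule symI)
      fix x y assume "(x, y) \<in> R"
      then obtain i where xy: "x \<in> ?N" "y \<in> ?N" and "y = (f ^^ i) x"
        unfolding R_def by blast
      then have "x = (f ^^ (p * i - i)) y"
        using return[of x i] by simp
      with xy show "(y, x) \<in> R"
        unfolding R_def by blast
    qed
    show "trans R"
    proof (rule transI)
      fix x y z assume "(x, y) \<in> R" "(y, z) \<in> R"
      then obtain i j where "x \<in> ?N" "z \<in> ?N" "z = (f ^^ j) ((f ^^ i) x)"
        unfolding R_def by blast
      then have "z = (f ^^ (j + i)) x"
        by (simp add: funpow_add)
      with \<open>x \<in> ?N\<close> \<open>z \<in> ?N\<close> show "(x, z) \<in> R"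
        unfolding R_def by blast
    qed
  qed
  moreover have "p dvd card C" if C: "C \<in> ?N // R" for C
  proof -
    obtain x where x: "x \<in> ?N" and "C = R `` {x}"
      using C by (auto simp: quotient_def)
    then have "C = range (\<lambda>i. (f ^^ i) x)"
      using N_closed[OF x] x unfolding R_def by blast
    also have "\<dots> = (\<lambda>i. (f ^^ i) x) ` {..<p}"
    proof
      show "range (\<lambda>i. (f ^^ i) x) \<subseteq> (\<lambda>i. (f ^^ i) x) ` {..<p}"
      proof clarify
        fix i
        have "(f ^^ i) x = (f ^^ (i mod p)) x"
          using funpow_mod_eq[OF period, of x] x by simp
        then show "(f ^^ i) x \<in> (\<lambda>i. (f ^^ i) x) ` {..<p}"
          using p1 by (intro image_eqI[of _ _ "i mod p"]) auto
      qed
    qed auto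
    finally have "C = (\<lambda>i. (f ^^ i) x) ` {..<p}" .
    moreover have "(f ^^ i) x \<noteq> (f ^^ j) x" if "i < j" "j < p" for i j
    proof
      assume eq: "(f ^^ i) x = (f ^^ j) x"
      let ?y = "(f ^^ i) x"
      have y: "?y \<in> ?N"
        by (rule N_closed[OF x])
      have "(f ^^ (j - i)) ?y = (f ^^ (j - i + i)) x"
        by (simp add: funpow_add)
      also have "\<dots> = ?y"
        using that eq by simp
      finally have "(f ^^ (j - i)) ?y = ?y" .
      moreover have "coprime (j - i) p"
        using coprime_below_prime[OF p, of "j - i"] that by simp
      ultimately have "f ?y = ?y"
        using fixed_if_coprime_iterate_fixed[of "j - i" f ?y p] period y p1 by auto
      with y show False
        by simp
    qed
    then have "inj_on (\<lambda>i. (f ^^ i) x) {..<p}"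
      by (auto simp: inj_on_def) (metis linorder_neqE_nat)
    ultimately show ?thesis
      by (simp add: card_image)
  qed
  ultimately have "p dvd card ?N"
    using fin by (intro equiv_imp_dvd_card[of ?N R]) auto
  moreover have "card S = card {x \<in> S. f x = x} + card ?N"
    using fin by (subst card_Un_disjoint[symmetric]) (auto intro: arg_cong[of _ _ card])
  ultimately show ?thesis
    by (auto simp: cong_def elim: dvdE)
qed

section \<open>Preorders fixed by the rotation of a block of prime size\<close>

text \<open>The action of a permutation \<open>f\<close> on relations is written as a preimage, because the same operation
also describes the restriction of a relation along an injection and its inflation along a
surjection.\<close>

definition pullback :: "('a \<Rightarrow> 'b) \<Rightarrow> 'a set \<Rightarrow> 'b rel \<Rightarrow> 'a rel" where
  "pullback f A r = {(x, y). x \<in> A \<and> y \<in> A \<and> (f x, f y) \<in> r}"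

definition singleton_class :: "'a rel \<Rightarrow> 'a \<Rightarrow> bool" where
  "singleton_class r c \<longleftrightarrow> (\<forall>x. (c, x) \<in> r \<and> (x, c) \<in> r \<longrightarrow> x = c)"

lemma preorder_pullback:
  assumes "preorder_on B r" and "f ` A \<subseteq> B"
  shows "preorder_on A (pullback f A r)"
  using assms unfolding preorder_on_def pullback_def refl_on_def trans_def by blast

lemma funpow_pullback:
  assumes "f ` A \<subseteq> A" and "r \<subseteq> A \<times> A"
  shows "(pullback f A ^^ i) r = pullback (f ^^ i) A r"
proof (induction i)
  case 0
  show ?case
    using assms(2) by (auto simp: pullback_def)
next
  case (Suc i)
  then show ?case
    using assms(1) by (auto simp: pullback_def funpow_swap1)
qed

definition rot :: "nat \<Rightarrow> nat \<Rightarrow> nat" where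
  "rot p x = (if x < p then Suc x mod p else x)"

lemma funpow_rot: "(rot p ^^ i) x = (if x < p then (x + i) mod p else x)"
  by (induction i) (auto simp: rot_def mod_Suc_eq)

lemma rot_in: "rot p ` {..<p + n} \<subseteq> {..<p + n}"
  by (auto simp: rot_def) (metis gr_implies_not0 mod_less_divisor not_gr_zero trans_less_add1)

text \<open>In the quotient of \<open>{..<p + n}\<close> that contracts the block to a point, the block becomes \<open>0\<close> and
the other points become \<open>1, \<dots>, n\<close>.  Conversely \<open>expand\<close> picks \<open>0\<close> as representative of the block.\<close>

definition collapse :: "nat \<Rightarrow> nat \<Rightarrow> nat" where
  "collapse p x = (if x < p then 0 else Suc (x - p))"

definition expand :: "nat \<Rightarrow> nat \<Rightarrow> nat" where
  "expand p i = (if i = 0 then 0 else p + (i - 1))"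

text \<open>The flag \<open>e\<close> says what happens inside the block, about which the quotient knows nothing: either all
of its points are equivalent, or they are pairwise incomparable.\<close>

definition blow_up :: "nat \<Rightarrow> nat \<Rightarrow> nat rel \<Rightarrow> bool \<Rightarrow> nat rel" where
  "blow_up p n Q e =
    {(x, y) \<in> pullback (collapse p) {..<p + n} Q. x < p \<and> y < p \<longrightarrow> e \<or> x = y}"

lemma rot_invariant_iterate:
  assumes pre: "preorder_on {..<p + n} r" and inv: "pullback (rot p) {..<p + n} r = r"
    and "x < p + n" "y < p + n"
  shows "((rot p ^^ i) x, (rot p ^^ i) y) \<in> r \<longleftrightarrow> (x, y) \<in> r"
proof -
  have "(pullback (rot p) {..<p + n} ^^ i) r = r"
    by (induction i) (use inv in auto)
  moreover have "(pullback (rot p) {..<p + n} ^^ i) r = pullback (rot p ^^ i) {..<p + n} r"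
    using pre by (intro funpow_pullback rot_in) (auto simp: preorder_on_def)
  ultimately have "(x, y) \<in> pullback (rot p ^^ i) {..<p + n} r \<longleftrightarrow> (x, y) \<in> r"
    by simp
  then show ?thesis
    using assms(3,4) by (simp add: pullback_def)
qed

lemma rot_invariant_outside:
  assumes pre: "preorder_on {..<p + n} r" and inv: "pullback (rot p) {..<p + n} r = r"
    and x: "x < p" and y: "p \<le> y" "y < p + n"
  shows "(x, y) \<in> r \<longleftrightarrow> (0, y) \<in> r" and "(y, x) \<in> r \<longleftrightarrow> (y, 0) \<in> r"
  using rot_invariant_iterate[OF pre inv, of 0 y x] rot_invariant_iterate[OF pre inv, of y 0 x] x y
  by (auto simp: funpow_rot)

text \<open>Reading \<open>0 \<le> d\<close> in the given preorder, the \<open>d\<close> with \<open>0 \<le> d\<close> form a subsemigroup of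
the cyclic group: rotating \<open>0 \<le> d\<close> by \<open>k * d\<close> gives \<open>k * d \<le> (k + 1) * d\<close>.\<close>

lemma rot_invariant_multiples:
  assumes pre: "preorder_on {..<p + n} r" and inv: "pullback (rot p) {..<p + n} r = r"
    and d: "(0, d) \<in> r" "d < p"
  shows "(0, k * d mod p) \<in> r"
proof (induction k)
  case 0
  show ?case
    using pre d by (auto simp: preorder_on_def refl_on_def)
next
  case (Suc k)
  have "((rot p ^^ (k * d)) 0, (rot p ^^ (k * d)) d) \<in> r"
    using rot_invariant_iterate[OF pre inv, of 0 d "k * d"] d by simp
  then have "(k * d mod p, Suc k * d mod p) \<in> r"
    using d by (simp add: funpow_rot)
  with Suc show ?case
    using pre by (meson preorder_on_def transE)
qed

text \<open>A cyclic group of prime order has only the two trivial subgroups, so one relation between distinct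
points of the block forces all of them.\<close>

lemma rot_invariant_inside:
  assumes p: "prime p" and pre: "preorder_on {..<p + n} r"
    and inv: "pullback (rot p) {..<p + n} r = r"
    and xy: "x < p" "y < p" "x \<noteq> y"
  shows "(x, y) \<in> r \<longleftrightarrow> (0, 1) \<in> r"
proof -
  have p1: "1 < p"
    using p prime_gt_1_nat by blast
  \<comment> \<open>The difference \<open>y - x\<close> modulo \<open>p\<close>.\<close>
  define d where "d = (if x < y then y - x else y + p - x)"
  have d: "0 < d" "d < p" "(d + x) mod p = y"
    using xy by (auto simp: d_def)
  have xd: "(x, y) \<in> r \<longleftrightarrow> (0, d) \<in> r"
    using rot_invariant_iterate[OF pre inv, of 0 d x] xy d by (simp add: funpow_rot)
  show ?thesis
  proof
    assume "(x, y) \<in> r"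
    have "coprime d p"
      by (rule coprime_below_prime[OF p d(1,2)])
    then obtain k where "[d * k = 1] (mod p)"
      using cong_solve_coprime_nat by auto
    then have "k * d mod p = 1"
      using p1 by (simp add: cong_def mult.commute)
    then show "(0, 1) \<in> r"
      using rot_invariant_multiples[OF pre inv, of d k] xd \<open>(x, y) \<in> r\<close> d by simp
  next
    assume "(0, 1) \<in> r"
    then have "(0, d) \<in> r"
      using rot_invariant_multiples[OF pre inv, of 1 d] p1 d by simp
    then show "(x, y) \<in> r"
      using xd by simp
  qed
qed

lemma expand_in: "0 < p \<Longrightarrow> expand p ` {..<Suc n} \<subseteq> {..<p + n}"
  by (auto simp: expand_def)

lemma collapse_in: "collapse p ` {..<p + n} \<subseteq> {..<Suc n}"
  by (auto simp: collapse_def)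

lemma collapse_expand: "0 < p \<Longrightarrow> collapse p (expand p i) = i"
  by (auto simp: collapse_def expand_def)

text \<open>If the points of the block are kept incomparable, transitivity could fail only through a point
\<open>y\<close> outside the block that is both above and below it, which is what a singleton class excludes.\<close>

lemma blow_up_preorder:
  assumes Q: "preorder_on {..<Suc n} Q" and e: "e \<or> singleton_class Q 0"
  shows "preorder_on {..<p + n} (blow_up p n Q e)"
proof -
  have P: "preorder_on {..<p + n} (pullback (collapse p) {..<p + n} Q)"
    by (rule preorder_pullback[OF Q collapse_in])
  have "trans (blow_up p n Q e)"
  proof (rule transI)
    fix x y z assume xy: "(x, y) \<in> blow_up p n Q e" and yz: "(y, z) \<in> blow_up p n Q e"
    then have "(x, z) \<in> pullback (collapse p) {..<p + n} Q"
      using P by (auto simp: blow_up_def preorder_on_def dest: transD)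
    moreover have "x = z" if "\<not> e" "x < p" "z < p"
    proof -
      \<comment> \<open>Both ends lie in the block, so \<open>y\<close> is equivalent to the block in the quotient.\<close>
      have "collapse p y = 0"
        using xy yz that e
        by (auto simp: blow_up_def pullback_def singleton_class_def collapse_def split: if_splits)
      then have "y < p"
        by (auto simp: collapse_def split: if_splits)
      then show ?thesis
        using xy yz that by (auto simp: blow_up_def)
    qed
    ultimately show "(x, z) \<in> blow_up p n Q e"
      by (auto simp: blow_up_def)
  qed
  then show ?thesis
    using P by (auto simp: preorder_on_def refl_on_def blow_up_def)
qed

lemma blow_up_rot_invariant:
  assumes "0 < p"
  shows "pullback (rot p) {..<p + n} (blow_up p n Q e) = blow_up p n Q e"
proof -
  have "collapse p (rot p x) = collapse p x" "rot p x < p \<longleftrightarrow> x < p" for x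
    using assms by (auto simp: collapse_def rot_def)
  moreover have "rot p x = rot p y \<longleftrightarrow> x = y" if "x < p" "y < p" for x y
    using that by (auto simp: rot_def mod_Suc split: if_splits)
  moreover have "rot p x < p + n \<longleftrightarrow> x < p + n" for x
    using assms by (auto simp: rot_def trans_less_add1)
  ultimately show ?thesis
    by (auto simp: blow_up_def pullback_def)
qed

lemma blow_up_collapse:
  assumes p: "prime p" and pre: "preorder_on {..<p + n} r"
    and inv: "pullback (rot p) {..<p + n} r = r"
  shows "blow_up p n (pullback (expand p) {..<Suc n} r) ((0, 1) \<in> r) = r"
proof -
  have p0: "0 < p"
    using p prime_gt_0_nat by blast
  have refl: "(x, x) \<in> r" if "x < p + n" for x
    using pre that by (auto simp: preorder_on_def refl_on_def)
  have sub: "r \<subseteq> {..<p + n} \<times> {..<p + n}"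
    using pre by (simp add: preorder_on_def)
  have "(x, y) \<in> blow_up p n (pullback (expand p) {..<Suc n} r) ((0, 1) \<in> r) \<longleftrightarrow> (x, y) \<in> r"
    if xy: "x < p + n" "y < p + n" for x y
  proof -
    have cx: "collapse p x < Suc n" and cy: "collapse p y < Suc n"
      using xy collapse_in[of p n] by auto
    have ex: "expand p (collapse p z) = (if z < p then 0 else z)" for z
      by (auto simp: collapse_def expand_def)
    have "(x, y) \<in> blow_up p n (pullback (expand p) {..<Suc n} r) ((0, 1) \<in> r) \<longleftrightarrow>
        (if x < p then 0 else x, if y < p then 0 else y) \<in> r \<and>
        (x < p \<and> y < p \<longrightarrow> (0, 1) \<in> r \<or> x = y)"
      using xy cx cy by (simp add: blow_up_def pullback_def ex)
    also have "\<dots> \<longleftrightarrow> (x, y) \<in> r"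
    proof (cases "x < p"; cases "y < p")
      assume "x < p" "y < p"
      then show ?thesis
        using rot_invariant_inside[OF p pre inv, of x y] refl xy p0 by (cases "x = y") auto
    next
      assume "x < p" "\<not> y < p"
      then show ?thesis
        using rot_invariant_outside[OF pre inv, of x y] xy by simp
    next
      assume "\<not> x < p" "y < p"
      then show ?thesis
        using rot_invariant_outside[OF pre inv, of y x] xy by simp
    qed simp
    finally show ?thesis .
  qed
  moreover have "blow_up p n (pullback (expand p) {..<Suc n} r) ((0, 1) \<in> r)
      \<subseteq> {..<p + n} \<times> {..<p + n}"
    by (auto simp: blow_up_def pullback_def)
  ultimately show ?thesis
    using sub by (intro equalityI subrelI) blast+
qed

lemma collapse_blow_up:
  assumes p: "1 < p" and Q: "preorder_on {..<Suc n} Q"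
  shows "pullback (expand p) {..<Suc n} (blow_up p n Q e) = Q"
    and "(0, 1) \<in> blow_up p n Q e \<longleftrightarrow> e"
proof -
  have "expand p i < p + n" if "i < Suc n" for i
    using that p expand_in[of p n] by auto
  moreover have "expand p i < p \<longleftrightarrow> i = 0" for i
    using p by (auto simp: expand_def)
  ultimately show "pullback (expand p) {..<Suc n} (blow_up p n Q e) = Q"
    using Q p by (auto simp: blow_up_def pullback_def collapse_expand preorder_on_def)
  have "(0, 0) \<in> Q"
    using Q by (auto simp: preorder_on_def refl_on_def)
  then show "(0, 1) \<in> blow_up p n Q e \<longleftrightarrow> e"
    using p by (auto simp: blow_up_def pullback_def collapse_def)
qed

text \<open>An outside point equivalent to one point of the block is, by invariance, equivalent to all of them,
so transitivity through it would make the block indiscrete.\<close>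

lemma collapse_singleton_class:
  assumes p: "1 < p" and pre: "preorder_on {..<p + n} r"
    and inv: "pullback (rot p) {..<p + n} r = r" and "(0, 1) \<notin> r"
  shows "singleton_class (pullback (expand p) {..<Suc n} r) 0"
  unfolding singleton_class_def
proof (intro allI impI)
  fix i assume i: "(0, i) \<in> pullback (expand p) {..<Suc n} r \<and>
    (i, 0) \<in> pullback (expand p) {..<Suc n} r"
  show "i = 0"
  proof (rule ccontr)
    assume "i \<noteq> 0"
    then obtain y where y: "p \<le> y" "y < p + n" "(0, y) \<in> r" "(y, 0) \<in> r"
      using i by (intro that[of "p + (i - 1)"]) (auto simp: pullback_def expand_def)
    then have "(y, 1) \<in> r"
      using rot_invariant_outside(2)[OF pre inv, of 1 y] p by simp
    with y pre \<open>(0, 1) \<notin> r\<close> show False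
      by (meson preorder_on_def transE)
  qed
qed

lemma finite_preorders: "finite A \<Longrightarrow> finite {r. preorder_on A r}"
  by (rule finite_subset[of _ "Pow (A \<times> A)"]) (auto simp: preorder_on_def)

text \<open>An invariant preorder is the same thing as its quotient together with the flag \<open>e\<close>; the flag \<open>True\<close>
is possible for every quotient, the flag \<open>False\<close> only when the class of the block is a singleton.\<close>

lemma card_rot_invariant_preorders:
  assumes p: "prime p"
  shows "card {r. preorder_on {..<p + n} r \<and> pullback (rot p) {..<p + n} r = r} =
    card {Q. preorder_on {..<Suc n} Q} + card {Q. preorder_on {..<Suc n} Q \<and> singleton_class Q 0}"
    (is "card ?F = card ?P + card ?I")
proof -
  have p1: "1 < p"
    using p prime_gt_1_nat by blast
  have "bij_betw (\<lambda>r. (pullback (expand p) {..<Suc n} r, (0, 1) \<in> r)) ?F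
    (?P \<times> {True} \<union> ?I \<times> {False})"
  proof (rule bij_betw_byWitness[where f' = "\<lambda>(Q, e). blow_up p n Q e"])
    show "\<forall>r\<in>?F. (case (pullback (expand p) {..<Suc n} r, (0, 1) \<in> r) of
        (Q, e) \<Rightarrow> blow_up p n Q e) = r"
      using blow_up_collapse[OF p] by auto
    show "\<forall>z\<in>?P \<times> {True} \<union> ?I \<times> {False}.
        (pullback (expand p) {..<Suc n} (case z of (Q, e) \<Rightarrow> blow_up p n Q e),
         (0, 1) \<in> (case z of (Q, e) \<Rightarrow> blow_up p n Q e)) = z"
      using collapse_blow_up[OF p1] by auto
    show "(\<lambda>r. (pullback (expand p) {..<Suc n} r, (0, 1) \<in> r)) ` ?F
        \<subseteq> ?P \<times> {True} \<union> ?I \<times> {False}"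
      using preorder_pullback[OF _ expand_in[of p n]] collapse_singleton_class[OF p1] p1 by auto
    show "(\<lambda>(Q, e). blow_up p n Q e) ` (?P \<times> {True} \<union> ?I \<times> {False}) \<subseteq> ?F"
      using blow_up_preorder blow_up_rot_invariant p1 by auto
  qed
  then have "card ?F = card (?P \<times> {True} \<union> ?I \<times> {False})"
    by (rule bij_betw_same_card)
  also have "\<dots> = card (?P \<times> {True}) + card (?I \<times> {False})"
    using finite_preorders[of "{..<Suc n}"] by (intro card_Un_disjoint) auto
  finally show ?thesis
    by (simp add: card_cartesian_product)
qed

lemma num_topologies_cong:
  assumes p: "prime p"
  shows "[num_topologies (p + n) =
    card {Q. preorder_on {..<Suc n} Q} + card {Q. preorder_on {..<Suc n} Q \<and> singleton_class Q 0}]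
    (mod p)"
proof -
  let ?A = "{..<p + n}"
  have p0: "0 < p"
    using p prime_gt_0_nat by blast
  have "[card {r. preorder_on ?A r} =
      card {r \<in> {r. preorder_on ?A r}. pullback (rot p) ?A r = r}] (mod p)"
  proof (rule cong_card_fixed_points[OF p])
    show "finite {r. preorder_on ?A r}"
      by (simp add: finite_preorders)
    show "pullback (rot p) ?A ` {r. preorder_on ?A r} \<subseteq> {r. preorder_on ?A r}"
      using preorder_pullback[OF _ rot_in] by auto
    fix r assume "r \<in> {r. preorder_on ?A r}"
    then have sub: "r \<subseteq> ?A \<times> ?A"
      by (simp add: preorder_on_def)
    have "(rot p ^^ p) x = x" for x
      by (simp add: funpow_rot)
    then have "pullback (rot p ^^ p) ?A r = r"
      using sub by (auto simp: pullback_def)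
    then show "(pullback (rot p) ?A ^^ p) r = r"
      by (simp add: funpow_pullback[OF rot_in sub])
  qed
  then show ?thesis
    by (simp add: num_topologies_def card_topologies_eq_card_preorders
        card_rot_invariant_preorders[OF p, symmetric])
qed

section \<open>Enumeration of preorders by Boolean matrices\<close>

text \<open>Matrices of Booleans with constructor-based operations are chosen because they make the final
count a computation by rewriting alone.\<close>

type_synonym bmatrix = "bool list list"

definition square :: "nat \<Rightarrow> bmatrix \<Rightarrow> bool" where
  "square n M \<longleftrightarrow> length M = n \<and> (\<forall>i<n. length (M ! i) = n)"

definition preorder_matrix :: "nat \<Rightarrow> bmatrix \<Rightarrow> bool" where
  "preorder_matrix n M \<longleftrightarrow> square n M \<and> (\<forall>i<n. M ! i ! i) \<and>
    (\<forall>i<n. \<forall>j<n. \<forall>k<n. M ! i ! j \<longrightarrow> M ! j ! k \<longrightarrow> M ! i ! k)"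

definition matrix_of :: "nat \<Rightarrow> nat rel \<Rightarrow> bmatrix" where
  "matrix_of n r = map (\<lambda>i. map (\<lambda>j. (i, j) \<in> r) [0..<n]) [0..<n]"

text \<open>The new point gets index \<open>0\<close> and the old points are shifted up by one, which keeps bordering a
purely structural operation on lists: \<open>U\<close> lists the old points above the new one, \<open>D\<close> those below.\<close>

definition border :: "bool list \<Rightarrow> bool list \<Rightarrow> bmatrix \<Rightarrow> bmatrix" where
  "border U D M = (True # U) # map2 (#) D M"

definition up_closed :: "bmatrix \<Rightarrow> bool list \<Rightarrow> bool" where
  "up_closed M U = list_all2 (\<lambda>u r. u \<longrightarrow> list_all2 (\<longrightarrow>) r U) U M"

text \<open>Stated contrapositively, so that it runs through the rows of \<open>M\<close> only and never needs a column: the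
points above a point outside \<open>D\<close> lie outside \<open>D\<close>.\<close>

definition down_closed :: "bmatrix \<Rightarrow> bool list \<Rightarrow> bool" where
  "down_closed M D = list_all2 (\<lambda>d r. \<not> d \<longrightarrow> list_all2 (\<lambda>a b. \<not> (a \<and> b)) r D) D M"

definition all_below :: "bmatrix \<Rightarrow> bool list \<Rightarrow> bool list \<Rightarrow> bool" where
  "all_below M D U = list_all2 (\<lambda>d r. d \<longrightarrow> list_all2 (\<longrightarrow>) U r) D M"

text \<open>Filtering the candidates for \<open>U\<close> and for \<open>D\<close> separately before they are paired keeps the number of
pairs that have to be examined small.\<close>

definition borders :: "bmatrix \<Rightarrow> (bool list \<times> bool list) list" where
  "borders M =
    (let S = List.n_lists (length M) [False, True];
         Us = filter (up_closed M) S;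
         Ds = filter (down_closed M) S
     in concat (map (\<lambda>U. map (Pair U) (filter (\<lambda>D. all_below M D U) Ds)) Us))"

fun preorder_matrices :: "nat \<Rightarrow> bmatrix list" where
  "preorder_matrices 0 = [[]]"
| "preorder_matrices (Suc n) =
    concat (map (\<lambda>M. map (\<lambda>(U, D). border U D M) (borders M)) (preorder_matrices n))"

definition singleton_head :: "bmatrix \<Rightarrow> bool" where
  "singleton_head M \<longleftrightarrow> (\<forall>i<length M. M ! 0 ! i \<and> M ! i ! 0 \<longrightarrow> i = 0)"

text \<open>The weights are read off the borders, so that the largest matrices, which are by far the most
numerous, are never built during the evaluation.\<close>

definition weighted_count :: "nat \<Rightarrow> int" where
  "weighted_count n = (\<Sum>M\<leftarrow>preorder_matrices n. \<Sum>(U, D)\<leftarrow>borders M.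
    if list_all2 (\<lambda>u d. \<not> (u \<and> d)) U D then 2 else 1)"

lemma distinct_concat_map:
  assumes "distinct xs" and "\<And>x. x \<in> set xs \<Longrightarrow> distinct (f x)"
    and "\<And>x y. x \<in> set xs \<Longrightarrow> y \<in> set xs \<Longrightarrow> x \<noteq> y \<Longrightarrow> set (f x) \<inter> set (f y) = {}"
  shows "distinct (concat (map f xs))"
  using assms
proof (induction xs)
  case (Cons x xs)
  have "distinct (concat (map f xs))"
    using Cons.prems by (intro Cons.IH) auto
  moreover have "set (f x) \<inter> set (f y) = {}" if "y \<in> set xs" for y
    using Cons.prems(1) Cons.prems(3)[of x y] that by auto
  ultimately show ?case
    using Cons.prems(2)[of x] by auto
qed simp

lemma distinct_borders: "distinct (borders M)"
  unfolding borders_def Let_def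
  by (intro distinct_concat_map)
    (auto simp: distinct_map distinct_n_lists inj_on_def)

lemma up_closed_iff:
  assumes "square n M" and "length U = n"
  shows "up_closed M U \<longleftrightarrow> (\<forall>i<n. \<forall>j<n. U ! i \<longrightarrow> M ! i ! j \<longrightarrow> U ! j)"
proof -
  have "up_closed M U \<longleftrightarrow> (\<forall>i<n. U ! i \<longrightarrow> (\<forall>j<n. M ! i ! j \<longrightarrow> U ! j))"
    using assms by (auto simp: up_closed_def list_all2_conv_all_nth square_def)
  then show ?thesis
    by blast
qed

lemma down_closed_iff:
  assumes "square n M" and "length D = n"
  shows "down_closed M D \<longleftrightarrow> (\<forall>i<n. \<forall>j<n. M ! i ! j \<longrightarrow> D ! j \<longrightarrow> D ! i)"
proof -
  have "down_closed M D \<longleftrightarrow> (\<forall>i<n. \<not> D ! i \<longrightarrow> (\<forall>j<n. \<not> (M ! i ! j \<and> D ! j)))"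
    using assms by (auto simp: down_closed_def list_all2_conv_all_nth square_def)
  then show ?thesis
    by blast
qed

lemma all_below_iff:
  assumes "square n M" and "length D = n" and "length U = n"
  shows "all_below M D U \<longleftrightarrow> (\<forall>i<n. \<forall>j<n. D ! i \<longrightarrow> U ! j \<longrightarrow> M ! i ! j)"
proof -
  have "all_below M D U \<longleftrightarrow> (\<forall>i<n. D ! i \<longrightarrow> (\<forall>j<n. U ! j \<longrightarrow> M ! i ! j))"
    using assms by (auto simp: all_below_def list_all2_conv_all_nth square_def)
  then show ?thesis
    by blast
qed

lemma mem_borders_iff:
  assumes "square n M"
  shows "(U, D) \<in> set (borders M) \<longleftrightarrow> length U = n \<and> length D = n \<and>
    (\<forall>i<n. \<forall>j<n. U ! i \<longrightarrow> M ! i ! j \<longrightarrow> U ! j) \<and>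
    (\<forall>i<n. \<forall>j<n. M ! i ! j \<longrightarrow> D ! j \<longrightarrow> D ! i) \<and>
    (\<forall>i<n. \<forall>j<n. D ! i \<longrightarrow> U ! j \<longrightarrow> M ! i ! j)"
proof -
  have "\<And>xs :: bool list. set xs \<subseteq> {False, True}"
    by auto
  then have "(U, D) \<in> set (borders M) \<longleftrightarrow> length U = n \<and> length D = n \<and>
    up_closed M U \<and> down_closed M D \<and> all_below M D U"
    using assms by (auto simp: borders_def Let_def square_def set_n_lists)
  then show ?thesis
    using up_closed_iff[OF assms, of U] down_closed_iff[OF assms, of D]
      all_below_iff[OF assms, of D U]
    by argo
qed

text \<open>This is what keeps the enumeration free of repetitions.\<close>

lemma border_inject:
  assumes "length D = length M" and "length D' = length M'"
    and "border U D M = border U' D' M'"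
  shows "U = U' \<and> D = D' \<and> M = M'"
proof -
  have heads: "map hd (map2 (#) D M) = D" "map tl (map2 (#) D M) = M" if "length D = length M"
    for D and M :: bmatrix
    using that by (auto simp: list_eq_iff_nth_eq)
  from assms show ?thesis
    by (metis border_def heads list.inject)
qed

text \<open>Transitivity of the bordered matrix is split according to which of the three indices are the new
point.  Of the eight cases, \<open>000\<close>, \<open>00k\<close>, \<open>0j0\<close> and \<open>i00\<close> are trivial; \<open>0jk\<close>, \<open>ij0\<close> and \<open>i0k\<close> say that
\<open>U\<close> is an up-set, that \<open>D\<close> is a down-set and that \<open>D\<close> lies below \<open>U\<close>; \<open>ijk\<close> is transitivity of \<open>M\<close>.\<close>

lemma preorder_matrix_border:
  assumes "length U = n" and "length D = n" and "square n M"
  shows "preorder_matrix (Suc n) (border U D M) \<longleftrightarrow>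
    preorder_matrix n M \<and> (U, D) \<in> set (borders M)"
proof -
  let ?N = "border U D M"
  have len: "length M = n" "\<And>i. i < n \<Longrightarrow> length (M ! i) = n"
    using assms(3) by (auto simp: square_def)
  have entries: "?N ! 0 ! 0" "\<And>j. ?N ! 0 ! Suc j = U ! j"
    "\<And>i. i < n \<Longrightarrow> ?N ! Suc i ! 0 = D ! i"
    "\<And>i j. i < n \<Longrightarrow> ?N ! Suc i ! Suc j = M ! i ! j"
    using assms len by (simp_all add: border_def)
  have sq: "square (Suc n) ?N"
    using assms len by (simp add: square_def border_def All_less_Suc2)
  have refl: "(\<forall>i<Suc n. ?N ! i ! i) \<longleftrightarrow> (\<forall>i<n. M ! i ! i)"
    by (simp add: All_less_Suc2 entries)
  have trans: "(\<forall>i<Suc n. \<forall>j<Suc n. \<forall>k<Suc n. ?N ! i ! j \<longrightarrow> ?N ! j ! k \<longrightarrow> ?N ! i ! k) \<longleftrightarrow>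
    (\<forall>i<n. \<forall>j<n. \<forall>k<n. M ! i ! j \<longrightarrow> M ! j ! k \<longrightarrow> M ! i ! k) \<and>
    (\<forall>i<n. \<forall>j<n. U ! i \<longrightarrow> M ! i ! j \<longrightarrow> U ! j) \<and>
    (\<forall>i<n. \<forall>j<n. M ! i ! j \<longrightarrow> D ! j \<longrightarrow> D ! i) \<and>
    (\<forall>i<n. \<forall>j<n. D ! i \<longrightarrow> U ! j \<longrightarrow> M ! i ! j)"
    by (simp add: All_less_Suc2 entries imp_conjR all_conj_distrib conj_ac)
  show ?thesis
    unfolding preorder_matrix_def mem_borders_iff[OF assms(3)] refl trans
    using sq assms by argo
qed

lemma square_SucE:
  assumes "square (Suc n) N" and "N ! 0 ! 0"
  obtains U D M where "length U = n" "length D = n" "square n M" "N = border U D M"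
proof
  let ?U = "tl (hd N)" and ?D = "map hd (tl N)" and ?M = "map tl (tl N)"
  have len: "length N = Suc n" "\<And>i. i < Suc n \<Longrightarrow> length (N ! i) = Suc n"
    using assms by (auto simp: square_def)
  then obtain R Rs where N: "N = R # Rs"
    by (cases N) auto
  have R: "length R = Suc n" "R ! 0"
    using len(2)[of 0] assms(2) N by auto
  have Rs: "length Rs = n" "\<And>i. i < n \<Longrightarrow> length (Rs ! i) = Suc n"
    using len(1) len(2)[of "Suc _"] N by auto
  show "length ?U = n" "length ?D = n" "square n ?M"
    using R Rs by (auto simp: N square_def)
  have "R = True # tl R"
    using R by (cases R) auto
  moreover have "map2 (#) (map hd Rs) (map tl Rs) = Rs"
    using Rs by (intro nth_equalityI) (auto simp: hd_Cons_tl simp flip: length_greater_0_conv)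
  ultimately show "N = border ?U ?D ?M"
    by (simp add: border_def N)
qed

lemma set_preorder_matrices: "set (preorder_matrices n) = {M. preorder_matrix n M}"
proof (induction n)
  case 0
  show ?case
    by (auto simp: preorder_matrix_def square_def)
next
  case (Suc n)
  have "N \<in> set (preorder_matrices (Suc n)) \<longleftrightarrow> preorder_matrix (Suc n) N" for N
  proof
    assume "N \<in> set (preorder_matrices (Suc n))"
    then obtain M U D where M: "preorder_matrix n M" and UD: "(U, D) \<in> set (borders M)"
      and N: "N = border U D M"
      using Suc by auto
    have sq: "square n M"
      using M by (simp add: preorder_matrix_def)
    moreover have "length U = n" "length D = n"
      using UD by (auto simp: mem_borders_iff[OF sq])
    ultimately show "preorder_matrix (Suc n) N"
      using M UD N preorder_matrix_border by blast
  next
    assume N: "preorder_matrix (Suc n) N"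
    then obtain U D M where "length U = n" "length D = n" "square n M" "N = border U D M"
      using square_SucE[of n N] by (auto simp: preorder_matrix_def)
    then have "preorder_matrix n M" "(U, D) \<in> set (borders M)"
      using N preorder_matrix_border by blast+
    then show "N \<in> set (preorder_matrices (Suc n))"
      using Suc \<open>N = border U D M\<close> by force
  qed
  then show ?case
    by blast
qed

lemma length_borders:
  assumes "M \<in> set (preorder_matrices n)" and "(U, D) \<in> set (borders M)"
  shows "length U = length M \<and> length D = length M"
proof -
  have sq: "square n M"
    using assms(1) unfolding set_preorder_matrices preorder_matrix_def by blast
  then have "length M = n"
    by (simp add: square_def)
  with mem_borders_iff[OF sq, of U D] assms(2) show ?thesis
    by argo
qed

lemma distinct_preorder_matrices: "distinct (preorder_matrices n)"
proof (induction n)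
  case (Suc n)
  show ?case
    unfolding preorder_matrices.simps
  proof (rule distinct_concat_map[OF Suc])
    fix M assume M: "M \<in> set (preorder_matrices n)"
    have "inj_on (\<lambda>(U, D). border U D M) (set (borders M))"
      using length_borders[OF M] border_inject by (fastforce simp: inj_on_def)
    then show "distinct (map (\<lambda>(U, D). border U D M) (borders M))"
      by (simp add: distinct_map distinct_borders)
  next
    fix M M' assume M: "M \<in> set (preorder_matrices n)" "M' \<in> set (preorder_matrices n)" "M \<noteq> M'"
    have "border U D M \<noteq> border U' D' M'"
      if "(U, D) \<in> set (borders M)" "(U', D') \<in> set (borders M')" for U D U' D'
      using length_borders that M border_inject by blast
    then show "set (map (\<lambda>(U, D). border U D M) (borders M)) \<inter>
        set (map (\<lambda>(U, D). border U D M') (borders M')) = {}"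
      by auto
  qed
qed simp

lemma bij_betw_matrix_of:
  "bij_betw (matrix_of n) {r. preorder_on {..<n} r} (set (preorder_matrices n))"
  unfolding set_preorder_matrices
proof (rule bij_betw_byWitness[where f' = "\<lambda>M. {(i, j). i < n \<and> j < n \<and> M ! i ! j}"])
  have entry: "matrix_of n r ! i ! j \<longleftrightarrow> (i, j) \<in> r" if "i < n" "j < n" for r i j
    using that by (simp add: matrix_of_def)
  have square: "square n (matrix_of n r)" for r
    by (simp add: square_def matrix_of_def)
  show "\<forall>r\<in>{r. preorder_on {..<n} r}.
      {(i, j). i < n \<and> j < n \<and> matrix_of n r ! i ! j} = r"
    by (auto simp: preorder_on_def entry)
  show "\<forall>M\<in>{M. preorder_matrix n M}.
      matrix_of n {(i, j). i < n \<and> j < n \<and> M ! i ! j} = M"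
  proof clarify
    fix M assume "preorder_matrix n M"
    then have "square n M"
      unfolding preorder_matrix_def by blast
    then show "matrix_of n {(i, j). i < n \<and> j < n \<and> M ! i ! j} = M"
      by (auto simp: square_def matrix_of_def intro!: nth_equalityI)
  qed
  show "matrix_of n ` {r. preorder_on {..<n} r} \<subseteq> {M. preorder_matrix n M}"
  proof clarify
    fix r assume r: "preorder_on {..<n} r"
    then have "\<forall>i<n. (i, i) \<in> r"
      by (simp add: preorder_on_def refl_on_def)
    moreover have "trans r"
      using r by (simp add: preorder_on_def)
    ultimately show "preorder_matrix n (matrix_of n r)"
      using square by (simp add: preorder_matrix_def entry) (meson transE)
  qed
  show "(\<lambda>M. {(i, j). i < n \<and> j < n \<and> M ! i ! j}) ` {M. preorder_matrix n M}
      \<subseteq> {r. preorder_on {..<n} r}"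
  proof clarify
    fix M assume M: "preorder_matrix n M"
    have "trans {(i, j). i < n \<and> j < n \<and> M ! i ! j}"
    proof (rule transI, clarify)
      fix i j k assume "i < n" "j < n" "k < n" "M ! i ! j" "M ! j ! k"
      with M show "M ! i ! k"
        unfolding preorder_matrix_def by blast
    qed
    moreover have "\<forall>i<n. M ! i ! i"
      using M unfolding preorder_matrix_def by blast
    ultimately show "preorder_on {..<n} {(i, j). i < n \<and> j < n \<and> M ! i ! j}"
      by (auto simp: preorder_on_def refl_on_def)
  qed
qed

lemma singleton_head_matrix_of:
  assumes "preorder_on {..<Suc n} r"
  shows "singleton_head (matrix_of (Suc n) r) \<longleftrightarrow> singleton_class r 0"
proof -
  have "singleton_head (matrix_of (Suc n) r) \<longleftrightarrow>
      (\<forall>i<Suc n. (0, i) \<in> r \<and> (i, 0) \<in> r \<longrightarrow> i = 0)"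
    by (simp add: singleton_head_def matrix_of_def del: upt_Suc)
  also have "\<dots> \<longleftrightarrow> singleton_class r 0"
    using assms by (auto simp: singleton_class_def preorder_on_def)
  finally show ?thesis .
qed

lemma singleton_head_border:
  assumes "length U = length M" and "length D = length M"
  shows "singleton_head (border U D M) \<longleftrightarrow> list_all2 (\<lambda>u d. \<not> (u \<and> d)) U D"
  using assms by (auto simp: singleton_head_def border_def list_all2_conv_all_nth All_less_Suc2)

lemma weighted_count_eq_sum:
  "weighted_count n = (\<Sum>N\<in>set (preorder_matrices (Suc n)). if singleton_head N then 2 else 1)"
proof -
  let ?w = "\<lambda>N. if singleton_head N then 2 else (1 :: int)"
  have concat: "sum_list (concat xss) = sum_list (map sum_list xss)" for xss :: "int list list"
    by (induction xss) auto
  have "(\<Sum>N\<in>set (preorder_matrices (Suc n)). ?w N) = sum_list (map ?w (preorder_matrices (Suc n)))"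
    by (rule sum_list_distinct_conv_sum_set[OF distinct_preorder_matrices, symmetric])
  also have "\<dots> = (\<Sum>M\<leftarrow>preorder_matrices n. \<Sum>(U, D)\<leftarrow>borders M. ?w (border U D M))"
    by (simp add: map_concat concat comp_def case_prod_unfold)
  also have "\<dots> = weighted_count n"
    unfolding weighted_count_def
  proof (intro arg_cong[where f = sum_list] map_cong refl, clarify)
    fix M U D assume "M \<in> set (preorder_matrices n)" "(U, D) \<in> set (borders M)"
    then show "?w (border U D M) = (if list_all2 (\<lambda>u d. \<not> (u \<and> d)) U D then 2 else 1)"
      using length_borders singleton_head_border[of U M D] by simp
  qed
  finally show ?thesis ..
qed

lemma weighted_count_eq_card:
  "weighted_count n = int (card {Q. preorder_on {..<Suc n} Q} +
    card {Q. preorder_on {..<Suc n} Q \<and> singleton_class Q 0})"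
proof -
  let ?P = "{Q. preorder_on {..<Suc n} Q}"
  have fin: "finite ?P"
    using bij_betw_finite[OF bij_betw_matrix_of] by blast
  have "weighted_count n = (\<Sum>Q\<in>?P. if singleton_head (matrix_of (Suc n) Q) then 2 else 1)"
    unfolding weighted_count_eq_sum by (rule sum.reindex_bij_betw[OF bij_betw_matrix_of, symmetric])
  also have "\<dots> = (\<Sum>Q\<in>?P. 1 + (if singleton_class Q 0 then 1 else 0))"
    by (intro sum.cong) (auto simp: singleton_head_matrix_of)
  also have "\<dots> = int (card ?P) + int (card (?P \<inter> {Q. singleton_class Q 0}))"
    using fin by (simp add: sum.distrib sum.If_cases)
  also have "?P \<inter> {Q. singleton_class Q 0} = {Q. preorder_on {..<Suc n} Q \<and> singleton_class Q 0}"
    by blast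
  finally show ?thesis
    by simp
qed

section \<open>The values of the sequence\<close>

text \<open>Two candidates for the value agree modulo every prime, hence modulo a prime exceeding
their distance.\<close>

lemma k_seq_eqI:
  assumes "\<And>p. prime p \<Longrightarrow> [int (num_topologies (p + n)) = c] (mod int p)"
  shows "k_seq n = c"
  unfolding k_seq_def
proof (rule the_equality)
  show "\<forall>p. prime p \<longrightarrow> [int (num_topologies (p + n)) = c] (mod int p)"
    using assms by blast
  fix c' assume c': "\<forall>p. prime p \<longrightarrow> [int (num_topologies (p + n)) = c'] (mod int p)"
  obtain p where p: "prime p" "nat \<bar>c' - c\<bar> < p"
    using bigger_prime by blast
  then have "[c' = c] (mod int p)"
    using c' assms by (meson cong_sym cong_trans)
  then have "int p dvd c' - c"
    by (simp add: cong_iff_dvd_diff)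
  then show "c' = c"
    using p zdvd_imp_le[of "int p" "\<bar>c' - c\<bar>"] by fastforce
qed

lemma k_seq_eq_weighted_count: "k_seq n = weighted_count n"
proof (rule k_seq_eqI)
  fix p :: nat
  assume "prime p"
  then show "[int (num_topologies (p + n)) = weighted_count n] (mod int p)"
    unfolding weighted_count_eq_card cong_int_iff by (rule num_topologies_cong)
qed

theorem theorem2p12:
  shows "k_seq 0 = 2 \<and> k_seq 1 = 7 \<and> k_seq 2 = 51 \<and> k_seq 3 = 634 \<and> k_seq 4 = 12623"
  unfolding k_seq_eq_weighted_count
proof (intro conjI)
  show "weighted_count 0 = 2"
    by code_simp
  show "weighted_count 1 = 7"
    by code_simp
  show "weighted_count 2 = 51"
    by code_simp
  show "weighted_count 3 = 634"
    by code_simp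
  show "weighted_count 4 = 12623"
    by code_simp
qed

end
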